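(* Let $s\ge2$, $k\ge0$, $1\le t\le s-1$, $1\le r\le t$, and $n,p\ge0$ be integers. The number of words $\pi\in[sk+t]^n$ with $\overleftarrow{\mathrm{des}}_{R_r}(\pi)=p$, which also equals the number of words $\pi\in[sk+t]^n$ with $\overleftarrow{\mathrm{ris}}_{R_{t+1-r}}(\pi)=p$, is $$\sum_{m=0}^n\sum_{j=0}^m\sum_{i_1=0}^{m-j}\sum_{i_2=0}^{j}(-1)^{n+p+j}s^{m-i_1-i_2}(s-t+r-1)^{i_1}(r-1)^{i_2}\binom{m}{j}\binom{m-j}{i_1}\binom{j}{i_2}\binom{kj+j}{n-i_1-i_2}\binom{n-m}{p}.$$
   Context: $[N]=\{1,\ldots,N\}$ and $[N]^n$ is the set of words of length $n$ over $[N]$. For an integer $c$, $R_c=\{x\in\mathbb{N}: x\equiv c \pmod s\}$. For a word $\pi=\pi_1\cdots\pi_n$ and $X\subseteq\mathbb{N}$, $\overleftarrow{\mathrm{des}}_X(\pi)=|\{i:\pi_i>\pi_{i+1},\ \pi_i\in X\}|$ and $\overleftarrow{\mathrm{ris}}_X(\pi)=|\{i:\pi_i<\pi_{i+1},\ \pi_i\in X\}|$. Conventions: $\binom{a}{b}=0$ if $b<0$ or $b>a$ (for $a\ge0$), and $0^0=1$. *)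

theory Defs
  imports Complex_Main "HOL-Number_Theory.Cong"
begin

definition words :: "nat \<Rightarrow> nat \<Rightarrow> nat list set" where
  "words N n = {w. length w = n \<and> set w \<subseteq> {1..N}}"

definition residue_class :: "nat \<Rightarrow> int \<Rightarrow> nat set" where
  "residue_class s c = {x. [int x = c] (mod int s)}"

(* In des_left and ris_left the membership condition is on the left letter of the pair;
   list positions are 0-based. *)

definition des_left :: "nat set \<Rightarrow> nat list \<Rightarrow> nat" where
  "des_left X w = card {i. Suc i < length w \<and> w ! i > w ! Suc i \<and> w ! i \<in> X}"

definition ris_left :: "nat set \<Rightarrow> nat list \<Rightarrow> nat" where
  "ris_left X w = card {i. Suc i < length w \<and> w ! i < w ! Suc i \<and> w ! i \<in> X}"

end

theory Submission
  imports Defs "HOL-Computational_Algebra.Polynomial" "HOL-Computational_Algebra.Formal_Power_Series"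
begin

text \<open>
  Let \<open>W\<close> be the generating function of words, with \<open>x\<close> marking length and \<open>q = 1 + y\<close> marking
  descents from a letter of \<open>X = R\<^sub>r\<close>, and let \<open>x T\<^sub>a\<close> be the part coming from the nonempty words
  whose first letter is at most \<open>a\<close>. Removing the first letter gives
  \<open>T\<^sub>a\<^sub>+\<^sub>1 = (1 + x y [a + 1 \<in> X]) T\<^sub>a + W\<close> and \<open>W = 1 + x T\<^sub>N\<close>. Solving the linear recurrence for
  \<open>N = s k + t\<close>, with \<open>z = x y\<close>, yields \<open>y W = y + B(z) W\<close>, where
  \<open>B(z) = (1 + z)\<^sup>k\<^sup>+\<^sup>1 (s + (r - 1) z) - (s + (s - t + r - 1) z)\<close> has no constant term. Hence
  \<open>W = \<Sum>\<^sub>m y\<^sup>-\<^sup>m B(x y)\<^sup>m\<close>, and the formula is the coefficient of \<open>x\<^sup>n q\<^sup>p\<close>, expanded with the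
  binomial theorem. Complementing the letters exchanges descents and rises.
\<close>

unbundle fps_syntax

section \<open>Words and their left descents\<close>

lemma finite_words [simp]: "finite (words N n)"
  using finite_lists_length_eq[of "{1..N}" n] by (simp add: words_def conj_commute)

lemma words_0 [simp]: "words N 0 = {[]}"
  by (auto simp: words_def)

lemma words_Suc: "words N (Suc n) = (\<lambda>(a, w). a # w) ` ({1..N} \<times> words N n)"
  by (auto simp: words_def length_Suc_conv image_iff)

lemma sum_words_Suc:
  "(\<Sum>w\<in>words N (Suc n). f w) = (\<Sum>a=1..N. \<Sum>w\<in>words N n. f (a # w))"
proof -
  have "inj_on (\<lambda>(a, w). a # w) ({1..N} \<times> words N n)"
    by (auto simp: inj_on_def)
  then show ?thesis
    by (simp add: words_Suc sum.reindex sum.cartesian_product case_prod_unfold)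
qed

lemma des_left_Nil [simp]: "des_left X [] = 0"
  by (simp add: des_left_def)

lemma des_left_singleton [simp]: "des_left X [a] = 0"
  by (simp add: des_left_def)

lemma des_left_Cons_Cons:
  "des_left X (a # b # w) = (if b < a \<and> a \<in> X then 1 else 0) + des_left X (b # w)"
proof -
  let ?D = "\<lambda>w. {i. Suc i < length w \<and> w ! i > w ! Suc i \<and> w ! i \<in> X}"
  let ?A = "if b < a \<and> a \<in> X then {0::nat} else {}"
  have "i \<in> ?D (a # b # w) \<longleftrightarrow> i \<in> ?A \<union> Suc ` ?D (b # w)" for i
    by (cases i) auto
  then have "?D (a # b # w) = ?A \<union> Suc ` ?D (b # w)"
    by blast
  moreover have "finite (?D (b # w))"
    by (rule finite_subset[of _ "{..length (b # w)}"]) auto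
  moreover have "?A \<inter> Suc ` ?D (b # w) = {}"
    by auto
  ultimately have "card (?D (a # b # w)) = card ?A + card (?D (b # w))"
    by (simp only: card_Un_disjoint finite_imageI card_image[OF inj_Suc[THEN inj_on_subset]] subset_UNIV)
       (subst card_Un_disjoint, auto simp: card_image)
  then show ?thesis
    by (auto simp: des_left_def)
qed

section \<open>Complementation of letters\<close>

lemma ris_left_complement:
  assumes "w \<in> words N n" and "\<And>x. x \<in> {1..N} \<Longrightarrow> N + 1 - x \<in> Y \<longleftrightarrow> x \<in> X"
  shows "ris_left Y (map (\<lambda>x. N + 1 - x) w) = des_left X w"
proof -
  have range: "w ! i \<in> {1..N}" if "i < length w" for i
    using assms(1) that nth_mem by (fastforce simp: words_def)
  have "N + 1 - w ! i < N + 1 - w ! Suc i \<longleftrightarrow> w ! i > w ! Suc i"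
    and "N + 1 - w ! i \<in> Y \<longleftrightarrow> w ! i \<in> X" if "Suc i < length w" for i
    using range[of i] range[of "Suc i"] that assms(2)[of "w ! i"] by auto
  then show ?thesis
    unfolding ris_left_def des_left_def
    by (intro arg_cong[of _ _ card] Collect_cong) (simp cong: conj_cong)
qed

text \<open>Complementation is an involution on \<open>words N n\<close>, so it is its own inverse
  in the bijection. The sets \<open>X\<close> and \<open>Y\<close> need to correspond only on
  letters in \<open>{1..N}\<close>.\<close>

lemma card_des_left_eq_card_ris_left:
  assumes "\<And>x. x \<in> {1..N} \<Longrightarrow> N + 1 - x \<in> Y \<longleftrightarrow> x \<in> X"
  shows "card {w \<in> words N n. des_left X w = p} = card {w \<in> words N n. ris_left Y w = p}"
proof (rule bij_betw_same_card)
  let ?c = "map (\<lambda>x. N + 1 - x)"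
  have words: "?c w \<in> words N n" if "w \<in> words N n" for w
    using that by (fastforce simp: words_def)
  have inv: "?c (?c w) = w" if "w \<in> words N n" for w
    using that by (auto simp: words_def intro!: map_idI)
  have ris: "ris_left Y (?c w) = des_left X w" if "w \<in> words N n" for w
    using that assms by (rule ris_left_complement)
  have des: "des_left X (?c w) = ris_left Y w" if "w \<in> words N n" for w
    using ris[OF words[OF that]] unfolding inv[OF that] by (rule sym)
  show "bij_betw ?c {w \<in> words N n. des_left X w = p} {w \<in> words N n. ris_left Y w = p}"
    by (intro bij_betw_byWitness[where f' = ?c])
       (auto simp only: words inv ris des)
qed

section \<open>Generating functions of words by descents\<close>

context
  fixes N :: nat and X :: "nat set" and q :: "'a::comm_ring_1"
begin

text \<open>The weight \<open>q\<close> ranges over an arbitrary commutative ring so that it can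
  later be the polynomial variable \<open>[:0, 1:]\<close>.\<close>

definition des_sum :: "nat \<Rightarrow> 'a" where
  "des_sum n = (\<Sum>w\<in>words N n. q ^ des_left X w)"

definition des_sum_from :: "nat \<Rightarrow> nat \<Rightarrow> 'a" where
  "des_sum_from a n = (\<Sum>w\<in>words N n. q ^ des_left X (a # w))"

lemma des_sum_0 [simp]: "des_sum 0 = 1"
  by (simp add: des_sum_def)

lemma des_sum_Suc: "des_sum (Suc n) = (\<Sum>a=1..N. des_sum_from a n)"
  by (simp add: des_sum_def des_sum_from_def sum_words_Suc)

lemma des_sum_from_0 [simp]: "des_sum_from a 0 = 1"
  by (simp add: des_sum_from_def)

text \<open>The pair formed by \<open>Suc a\<close> and a next letter \<open>b\<close> is a descent
  exactly when \<open>b \<le> a\<close>. Writing its weight as \<open>q = 1 + (q - 1)\<close>, the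
  ones add up to \<open>des_sum (Suc n)\<close> and only the letters \<open>b \<le> a\<close> carry
  the correction.\<close>

lemma des_sum_from_Suc:
  assumes "a \<le> N"
  shows "des_sum_from (Suc a) (Suc n) =
    des_sum (Suc n) + (if Suc a \<in> X then q - 1 else 0) * (\<Sum>b=1..a. des_sum_from b n)"
proof -
  let ?y = "if Suc a \<in> X then q - 1 else 0"
  have "des_sum_from (Suc a) (Suc n) =
      (\<Sum>b=1..N. \<Sum>w\<in>words N n. q ^ des_left X (Suc a # b # w))"
    by (simp add: des_sum_from_def sum_words_Suc)
  also have "\<dots> = (\<Sum>b=1..N. (1 + (if b \<le> a then ?y else 0)) * des_sum_from b n)"
    unfolding des_sum_from_def sum_distrib_left
    by (intro sum.cong refl) (auto simp: des_left_Cons_Cons less_Suc_eq_le)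
  also have "\<dots> = des_sum (Suc n) + (\<Sum>b=1..N. if b \<le> a then ?y * des_sum_from b n else 0)"
    unfolding des_sum_Suc sum.distrib[symmetric]
    by (intro sum.cong refl) (auto simp: algebra_simps)
  also have "(\<Sum>b=1..N. if b \<le> a then ?y * des_sum_from b n else 0) =
      (\<Sum>b\<in>{1..a}. ?y * des_sum_from b n)"
    using assms by (intro sum.mono_neutral_cong_right) auto
  finally show ?thesis
    by (simp add: sum_distrib_left)
qed

definition des_fps :: "'a fps" where
  "des_fps = Abs_fps des_sum"

text \<open>This is \<open>T\<^sub>a\<close> of the overview. The exponent counts the letters after
  the first one, hence the factor \<open>fps_X\<close> in \<open>des_fps_eq\<close>.\<close>

definition des_fps_upto :: "nat \<Rightarrow> 'a fps" where
  "des_fps_upto a = Abs_fps (\<lambda>n. \<Sum>b=1..a. des_sum_from b n)"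

lemma des_fps_eq: "des_fps = 1 + fps_X * des_fps_upto N"
proof (rule fps_ext)
  fix n show "des_fps $ n = (1 + fps_X * des_fps_upto N) $ n"
    by (cases n) (simp_all add: des_fps_def des_fps_upto_def des_sum_Suc)
qed

lemma des_fps_upto_0 [simp]: "des_fps_upto 0 = 0"
  by (simp add: des_fps_upto_def fps_eq_iff)

text \<open>For positive exponents this is \<open>des_sum_from_Suc\<close>, where the drop from
  \<open>Suc n\<close> to \<open>n\<close> becomes the factor \<open>fps_X\<close>. The constant
  terms agree because both sides give \<open>a + 1\<close>.\<close>

lemma des_fps_upto_Suc:
  assumes "a \<le> N"
  shows "des_fps_upto (Suc a) =
    (if Suc a \<in> X then 1 + fps_const (q - 1) * fps_X else 1) * des_fps_upto a + des_fps"
proof (rule fps_ext)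
  fix n
  show "des_fps_upto (Suc a) $ n =
    ((if Suc a \<in> X then 1 + fps_const (q - 1) * fps_X else 1) * des_fps_upto a + des_fps) $ n"
    using assms
    by (cases n)
       (simp_all add: des_fps_upto_def des_fps_def des_sum_from_Suc algebra_simps mult.assoc)
qed

end

section \<open>Solving the recurrence for a residue class\<close>

text \<open>\<open>step_sum X z a\<close> is the ratio \<open>T\<^sub>a / W\<close>.\<close>

primrec step_sum :: "nat set \<Rightarrow> 'a::comm_ring_1 \<Rightarrow> nat \<Rightarrow> 'a" where
  "step_sum X z 0 = 0"
| "step_sum X z (Suc a) = (if Suc a \<in> X then 1 + z else 1) * step_sum X z a + 1"

lemma des_fps_upto_eq:
  assumes "a \<le> N"
  shows "des_fps_upto N X q a = des_fps N X q * step_sum X (fps_const (q - 1) * fps_X) a"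
  using assms by (induction a) (simp_all add: des_fps_upto_Suc algebra_simps)

lemma step_sum_gap:
  assumes "\<And>x. a < x \<Longrightarrow> x \<le> a + d \<Longrightarrow> x \<notin> X"
  shows "step_sum X z (a + d) = step_sum X z a + of_nat d"
  using assms by (induction d) (simp_all add: algebra_simps)

lemma mem_residue_class_iff:
  assumes "r < s" "d < s"
  shows "s * k + r + d \<in> residue_class s (int r) \<longleftrightarrow> d = 0"
proof -
  have "s * k + r + d \<in> residue_class s (int r) \<longleftrightarrow> int s dvd int (s * k + d)"
    by (simp add: residue_class_def cong_iff_dvd_diff)
  also have "\<dots> \<longleftrightarrow> s dvd d"
    unfolding int_dvd_int_iff by (simp add: dvd_add_right_iff)
  also have "\<dots> \<longleftrightarrow> d = 0"
    using assms by (auto dest: dvd_imp_le)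
  finally show ?thesis .
qed

lemma not_mem_residue_class_less:
  assumes "x < r" "r < s"
  shows "x \<notin> residue_class s (int r)"
  using assms by (auto simp: residue_class_def cong_def)

text \<open>Stopping at a member of the class makes each induction step one full period:
  \<open>s - 1\<close> letters outside the class, each adding 1, then one member. The factor
  \<open>z\<close> clears the denominator of the resulting geometric sum.\<close>

lemma step_sum_residue_class_at:
  fixes z :: "'a::comm_ring_1"
  assumes "1 \<le> r" "r < s"
  shows "z * step_sum (residue_class s (int r)) z (s * k + r) =
    (1 + z) ^ (k + 1) * (of_nat s + (of_nat r - 1) * z) - (of_nat s + (of_nat s - 1) * z)"
proof (induction k)
  let ?G = "step_sum (residue_class s (int r)) z"
  case 0
  have "?G (0 + (r - 1)) = ?G 0 + of_nat (r - 1)"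
    using assms by (intro step_sum_gap not_mem_residue_class_less) auto
  then have "?G (r - 1) = of_nat r - 1"
    using assms by (simp add: of_nat_diff)
  moreover have "Suc (r - 1) \<in> residue_class s (int r)"
    using assms by (simp add: residue_class_def)
  then have "?G (Suc (r - 1)) = (1 + z) * ?G (r - 1) + 1"
    by simp
  ultimately have G: "?G (s * 0 + r) = (1 + z) * (of_nat r - 1) + 1"
    using assms by simp
  show ?case
    unfolding G by (simp add: algebra_simps)
next
  let ?G = "step_sum (residue_class s (int r)) z"
  case (Suc k)
  \<comment> \<open>These \<open>x\<close> lie strictly between the consecutive members
    \<open>s * k + r\<close> and \<open>s * Suc k + r\<close>.\<close>
  have gap: "x \<notin> residue_class s (int r)"
    if "s * k + r < x" "x \<le> s * k + r + (s - 1)" for x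
    using mem_residue_class_iff[of r s "x - (s * k + r)" k] assms that by simp
  have last: "s * Suc k + r = Suc (s * k + r + (s - 1))"
    using assms by simp
  have "?G (s * k + r + (s - 1)) = ?G (s * k + r) + of_nat (s - 1)"
    by (rule step_sum_gap) (rule gap)
  moreover have "Suc (s * k + r + (s - 1)) \<in> residue_class s (int r)"
    using mem_residue_class_iff[of r s 0 "Suc k"] assms unfolding last by simp
  ultimately have "?G (s * Suc k + r) = (1 + z) * (?G (s * k + r) + of_nat (s - 1)) + 1"
    unfolding last by (simp only: step_sum.simps if_True)
  then have G: "?G (s * Suc k + r) = (1 + z) * (?G (s * k + r) + (of_nat s - 1)) + 1"
    using assms by (simp add: of_nat_diff)
  have "z * ?G (s * Suc k + r) =
      (1 + z) * (z * ?G (s * k + r)) + (1 + z) * z * (of_nat s - 1) + z"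
    unfolding G by (simp add: algebra_simps)
  then show ?case
    unfolding Suc.IH by (simp add: algebra_simps)
qed

text \<open>Since \<open>t - r < s\<close>, the letters after \<open>s * k + r\<close> up to
  \<open>s * k + t\<close> miss the class, so they add only \<open>t - r\<close> to the value at
  \<open>s * k + r\<close>.\<close>

lemma step_sum_residue_class:
  fixes z :: "'a::comm_ring_1"
  assumes "1 \<le> r" "r \<le> t" "t < s"
  shows "z * step_sum (residue_class s (int r)) z (s * k + t) =
    (1 + z) ^ (k + 1) * (of_nat s + (of_nat r - 1) * z)
      - (of_nat s + (of_nat s - of_nat t + of_nat r - 1) * z)"
proof -
  let ?G = "step_sum (residue_class s (int r)) z"
  have gap: "x \<notin> residue_class s (int r)"
    if "s * k + r < x" "x \<le> s * k + r + (t - r)" for x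
    using mem_residue_class_iff[of r s "x - (s * k + r)" k] assms that by simp
  have "?G (s * k + r + (t - r)) = ?G (s * k + r) + of_nat (t - r)"
    by (rule step_sum_gap) (rule gap)
  then have "?G (s * k + t) = ?G (s * k + r) + (of_nat t - of_nat r)"
    using assms by (simp add: of_nat_diff)
  then have "z * ?G (s * k + t) = z * ?G (s * k + r) + z * (of_nat t - of_nat r)"
    by (simp only: distrib_left)
  then show ?thesis
    unfolding step_sum_residue_class_at[OF assms(1) le_less_trans[OF assms(2,3)]]
    by (simp add: algebra_simps)
qed

section \<open>Coefficients of a geometric series\<close>

text \<open>Formally \<open>W = 1 + (B / c) * W\<close>. Iterating this \<open>M\<close> times and
  multiplying by \<open>c ^ M\<close> avoids any division.\<close>

lemma mult_power_geometric:
  fixes W :: "'a::comm_ring_1"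
  assumes "c * W = c + B * W"
  shows "c ^ M * W = (\<Sum>m<M. c ^ (M - m) * B ^ m) + B ^ M * W"
proof (induction M)
  case (Suc M)
  have "c ^ Suc M * W = c * ((\<Sum>m<M. c ^ (M - m) * B ^ m) + B ^ M * W)"
    unfolding Suc.IH[symmetric] by (simp only: power_Suc mult.assoc)
  also have "\<dots> = (\<Sum>m<M. c * (c ^ (M - m) * B ^ m)) + B ^ M * (c * W)"
    unfolding sum_distrib_left[symmetric] by (simp add: algebra_simps)
  also have "(\<Sum>m<M. c * (c ^ (M - m) * B ^ m)) = (\<Sum>m<M. c ^ (Suc M - m) * B ^ m)"
    by (intro sum.cong refl) (simp add: Suc_diff_le)
  finally show ?case
    unfolding assms by (simp add: algebra_simps)
qed simp

text \<open>With \<open>M = n + 1\<close> the remainder \<open>B ^ M * W\<close> has order above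
  \<open>n\<close>, as \<open>B\<close> has no constant term. The factor \<open>y ^ n\<close> in
  \<open>coeff\<close> absorbs the negative powers of \<open>y\<close>, and \<open>y ^ Suc n\<close>
  cancels in the integral domain.\<close>

lemma fps_nth_eq_of_geometric:
  fixes W :: "'a::idom fps"
  assumes eq: "fps_const y * W = fps_const y + B * W"
    and "y \<noteq> 0" and "B $ 0 = 0"
    and coeff: "\<And>m. m \<le> n \<Longrightarrow> B ^ m $ n = y ^ n * b m"
  shows "W $ n = (\<Sum>m\<le>n. y ^ (n - m) * b m)"
proof -
  have "(B ^ Suc n * W) $ n = 0"
  proof -
    have "B ^ Suc n $ i = 0" if "i \<le> n" for i
      using \<open>B $ 0 = 0\<close> that by (intro startsby_zero_power_prefix[rule_format]) auto
    then show ?thesis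
      by (auto simp: fps_mult_nth simp del: power_Suc intro!: sum.neutral)
  qed
  moreover have "(fps_const y ^ Suc n * W) $ n =
      (\<Sum>m<Suc n. fps_const y ^ (Suc n - m) * B ^ m) $ n + (B ^ Suc n * W) $ n"
    unfolding mult_power_geometric[OF eq] by simp
  ultimately have "y ^ Suc n * W $ n = (\<Sum>m\<le>n. y ^ (Suc n - m) * (B ^ m $ n))"
    by (simp add: fps_const_power fps_sum_nth lessThan_Suc_atMost del: power_Suc)
  also have "\<dots> = y ^ Suc n * (\<Sum>m\<le>n. y ^ (n - m) * b m)"
    unfolding sum_distrib_left
    by (intro sum.cong refl) (simp add: coeff Suc_diff_le algebra_simps)
  finally show ?thesis
    using \<open>y \<noteq> 0\<close> by simp
qed

section \<open>Binomial expansion of the kernel\<close>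

lemma one_plus_power_nth:
  "((1 + fps_const y * fps_X) ^ M) $ n = y ^ n * (of_nat (M choose n) :: 'a::comm_ring_1)"
proof -
  have "((1 + fps_const y * fps_X) ^ M) $ n =
      (\<Sum>i\<le>M. of_nat (M choose i) * (fps_const (y ^ i) * fps_X ^ i)) $ n"
    by (subst add.commute) (simp add: binomial_ring power_mult_distrib fps_const_power mult.assoc)
  also have "\<dots> = (\<Sum>i\<le>M. if i = n then of_nat (M choose i) * y ^ i else 0)"
    unfolding fps_sum_nth
    by (intro sum.cong refl) (auto simp: fps_of_nat[symmetric] fps_X_power_nth)
  finally show ?thesis
    by (auto simp: mult.commute binomial_eq_0)
qed

lemma linear_power_expand:
  fixes a c z :: "'a::comm_ring_1"
  shows "(a + c * z) ^ j = (\<Sum>i=0..j. of_nat (j choose i) * c ^ i * a ^ (j - i) * z ^ i)"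
  unfolding add.commute[of a] binomial_ring power_mult_distrib atLeast0AtMost
  by (intro sum.cong refl) (simp only: mult_ac)

text \<open>Here \<open>j\<close> of the \<open>m\<close> factors contribute the product with
  \<open>(1 + z) ^ (k + 1)\<close>, while \<open>i1\<close> and \<open>i2\<close> count the choices
  of \<open>d * z\<close> and \<open>c * z\<close>. Since \<open>z\<close> is \<open>y\<close> times
  the variable, the coefficient at \<open>n\<close> always carries \<open>y ^ n\<close>.\<close>

lemma kernel_power_nth:
  fixes a c d y :: "'a::comm_ring_1"
  defines "z \<equiv> fps_const y * fps_X"
  assumes "m \<le> n"
  shows "((1 + z) ^ (k + 1) * (fps_const a + fps_const c * z) - (fps_const a + fps_const d * z)) ^ m $ n
    = y ^ n * (\<Sum>j=0..m. \<Sum>i1=0..m-j. \<Sum>i2=0..j. (- 1) ^ (m + j) * a ^ (m - i1 - i2) * d ^ i1 * c ^ i2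
        * of_nat (m choose j) * of_nat ((m - j) choose i1) * of_nat (j choose i2)
        * of_nat ((k * j + j) choose (n - i1 - i2)))"
proof -
  let ?P = "(1 + z) ^ (k + 1) * (fps_const a + fps_const c * z)"
  let ?Q = "fps_const a + fps_const d * z"
  let ?f = "\<lambda>j i1 i2. (- 1) ^ (m + j) * a ^ (m - i1 - i2) * d ^ i1 * c ^ i2
        * of_nat (m choose j) * of_nat ((m - j) choose i1) * of_nat (j choose i2)"
  have nth: "(z ^ i * (1 + z) ^ M) $ n = y ^ n * of_nat (M choose (n - i))" if "i \<le> n" for i M
  proof -
    have "(z ^ i * (1 + z) ^ M) $ n = (fps_const (y ^ i) * (fps_X ^ i * (1 + z) ^ M)) $ n"
      by (simp add: z_def power_mult_distrib fps_const_power mult.assoc)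
    also have "\<dots> = y ^ i * (y ^ (n - i) * of_nat (M choose (n - i)))"
      using that by (simp add: fps_X_power_mult_nth z_def one_plus_power_nth)
    also have "\<dots> = y ^ n * of_nat (M choose (n - i))"
      using that by (simp add: mult.assoc[symmetric] power_add[symmetric])
    finally show ?thesis .
  qed
  have "(?P - ?Q) ^ m = (?P + (- ?Q)) ^ m"
    by (simp only: diff_conv_add_uminus)
  also have "\<dots> = (\<Sum>j=0..m. of_nat (m choose j) * ?P ^ j * (- ?Q) ^ (m - j))"
    by (simp only: binomial_ring atLeast0AtMost)
  also have "\<dots> = (\<Sum>j=0..m. \<Sum>i1=0..m-j. \<Sum>i2=0..j.
      fps_const (?f j i1 i2) * (z ^ (i1 + i2) * (1 + z) ^ (k * j + j)))"
  proof (intro sum.cong refl)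
    fix j assume "j \<in> {0..m}"
    then have j: "j \<le> m" by simp
    \<comment> \<open>The sign \<open>(- 1) ^ (m - j)\<close> is rewritten with
      \<open>m + j\<close>, which has the same parity and involves no subtraction.\<close>
    have "fps_const ((- 1) ^ (m + j)) = (- 1 :: 'a fps) ^ (m + j)"
      by (simp add: minus_one_power_iff fps_const_neg[symmetric] del: fps_const_neg)
    also have "\<dots> = (- 1) ^ (m - j)"
      using j by (simp add: minus_one_power_iff)
    finally have Q: "(- ?Q) ^ (m - j) = fps_const ((- 1) ^ (m + j)) * ?Q ^ (m - j)"
      by (simp only: power_minus[of ?Q])
    have P: "?P ^ j = (1 + z) ^ (k * j + j) * (fps_const a + fps_const c * z) ^ j"
      by (simp only: power_mult_distrib power_mult[symmetric] distrib_right mult_1_left)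
    have "of_nat (m choose j) * ?P ^ j * (- ?Q) ^ (m - j) =
        fps_const (of_nat (m choose j) * (- 1) ^ (m + j)) * (1 + z) ^ (k * j + j)
        * (?Q ^ (m - j) * (fps_const a + fps_const c * z) ^ j)"
      unfolding P Q fps_const_mult[symmetric] fps_of_nat[symmetric] by (simp only: mult_ac)
    also have "\<dots> = (\<Sum>i1=0..m-j. \<Sum>i2=0..j.
      fps_const (?f j i1 i2) * (z ^ (i1 + i2) * (1 + z) ^ (k * j + j)))"
      unfolding linear_power_expand sum_product unfolding sum_distrib_left
    proof (intro sum.cong refl)
      fix i1 i2 assume "i1 \<in> {0..m-j}" "i2 \<in> {0..j}"
      then have "m - i1 - i2 = (m - j - i1) + (j - i2)"
        using j by auto
      then have e: "a ^ (m - i1 - i2) = a ^ (m - j - i1) * a ^ (j - i2)"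
        by (simp add: power_add)
      show "fps_const (of_nat (m choose j) * (- 1) ^ (m + j)) * (1 + z) ^ (k * j + j) *
          (of_nat (m - j choose i1) * fps_const d ^ i1 * fps_const a ^ (m - j - i1) * z ^ i1 *
          (of_nat (j choose i2) * fps_const c ^ i2 * fps_const a ^ (j - i2) * z ^ i2)) =
        fps_const (?f j i1 i2) * (z ^ (i1 + i2) * (1 + z) ^ (k * j + j))"
        unfolding e fps_of_nat[symmetric] fps_const_mult[symmetric] fps_const_power[symmetric]
        by (simp only: power_add mult_ac)
    qed
    finally show "of_nat (m choose j) * ?P ^ j * (- ?Q) ^ (m - j) = (\<Sum>i1=0..m-j. \<Sum>i2=0..j.
      fps_const (?f j i1 i2) * (z ^ (i1 + i2) * (1 + z) ^ (k * j + j)))" .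
  qed
  finally have "(?P - ?Q) ^ m $ n = (\<Sum>j=0..m. \<Sum>i1=0..m-j. \<Sum>i2=0..j.
      ?f j i1 i2 * (z ^ (i1 + i2) * (1 + z) ^ (k * j + j)) $ n)"
    by (simp only: fps_sum_nth fps_mult_left_const_nth)
  also have "\<dots> = y ^ n * (\<Sum>j=0..m. \<Sum>i1=0..m-j. \<Sum>i2=0..j.
      ?f j i1 i2 * of_nat ((k * j + j) choose (n - i1 - i2)))"
    unfolding sum_distrib_left
  proof (intro sum.cong refl)
    fix j i1 i2 assume "j \<in> {0..m}" "i1 \<in> {0..m-j}" "i2 \<in> {0..j}"
    \<comment> \<open>Indeed \<open>i1 + i2 \<le> (m - j) + j = m\<close>, so the subtraction in
      \<open>n - i1 - i2\<close> is never truncated.\<close>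
    then have "i1 + i2 \<le> n"
      using \<open>m \<le> n\<close> by auto
    then show "?f j i1 i2 * (z ^ (i1 + i2) * (1 + z) ^ (k * j + j)) $ n =
        y ^ n * (?f j i1 i2 * of_nat ((k * j + j) choose (n - i1 - i2)))"
      by (simp only: nth mult_ac diff_diff_left)
  qed
  finally show ?thesis .
qed

section \<open>Weighted counts for a residue class and their coefficients in
  \<open>q\<close>\<close>

text \<open>The kernel comes from \<open>step_sum_residue_class\<close> with \<open>z\<close> equal
  to \<open>q - 1\<close> times the series variable; \<open>q \<noteq> 1\<close> permits the
  cancellation of powers of \<open>q - 1\<close>.\<close>

lemma des_sum_residue_class:
  fixes q :: "'a::idom"
  assumes "1 \<le> r" "r \<le> t" "t < s" "q \<noteq> 1"
  shows "des_sum (s * k + t) (residue_class s (int r)) q n =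
    (\<Sum>m\<le>n. (q - 1) ^ (n - m) * (\<Sum>j=0..m. \<Sum>i1=0..m-j. \<Sum>i2=0..j.
        (- 1) ^ (m + j) * of_nat s ^ (m - i1 - i2)
        * (of_nat s - of_nat t + of_nat r - 1) ^ i1 * (of_nat r - 1) ^ i2
        * of_nat (m choose j) * of_nat ((m - j) choose i1) * of_nat (j choose i2)
        * of_nat ((k * j + j) choose (n - i1 - i2))))"
proof -
  let ?N = "s * k + t" and ?X = "residue_class s (int r)"
  let ?W = "des_fps ?N ?X q"
  let ?c = "of_nat r - 1 :: 'a" and ?d = "of_nat s - of_nat t + of_nat r - 1 :: 'a"
  define z where "z = fps_const (q - 1) * fps_X"
  define B where "B = (1 + z) ^ (k + 1) * (fps_const (of_nat s) + fps_const ?c * z)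
    - (fps_const (of_nat s) + fps_const ?d * z)"
  have "z * step_sum ?X z ?N = B"
    unfolding B_def using assms step_sum_residue_class[of r t s z k]
    by (simp add: fps_of_nat fps_const_sub[symmetric] fps_const_add[symmetric]
        del: fps_const_sub fps_const_add)
  moreover have "?W = 1 + fps_X * (?W * step_sum ?X z ?N)"
    using des_fps_eq[of ?N ?X q] des_fps_upto_eq[of ?N ?N ?X q] by (simp add: z_def)
  \<comment> \<open>Multiplication by \<open>q - 1\<close> turns \<open>fps_X\<close> into
    \<open>z\<close>, so that the known product \<open>z * step_sum\<close> appears.\<close>
  then have "fps_const (q - 1) * ?W = fps_const (q - 1) * (1 + fps_X * (?W * step_sum ?X z ?N))"
    by simp
  then have "fps_const (q - 1) * ?W = fps_const (q - 1) + (z * step_sum ?X z ?N) * ?W"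
    unfolding z_def by (simp only: distrib_left mult_1_left mult_1_right mult_ac)
  ultimately have eq: "fps_const (q - 1) * ?W = fps_const (q - 1) + B * ?W"
    by simp
  \<comment> \<open>At \<open>z = 0\<close> both parts of \<open>B\<close> reduce to
    \<open>s\<close>.\<close>
  have "B $ 0 = 0"
    by (simp add: B_def z_def fps_power_zeroth)
  then have "?W $ n = (\<Sum>m\<le>n. (q - 1) ^ (n - m) * (\<Sum>j=0..m. \<Sum>i1=0..m-j. \<Sum>i2=0..j.
        (- 1) ^ (m + j) * of_nat s ^ (m - i1 - i2) * ?d ^ i1 * ?c ^ i2
        * of_nat (m choose j) * of_nat ((m - j) choose i1) * of_nat (j choose i2)
        * of_nat ((k * j + j) choose (n - i1 - i2))))"
    using \<open>q \<noteq> 1\<close> kernel_power_nth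
    by (intro fps_nth_eq_of_geometric[OF eq]) (simp_all add: B_def z_def)
  then show ?thesis
    by (simp add: des_fps_def)
qed

lemma coeff_des_sum:
  "coeff (des_sum N X [:0, 1:] n) p = int (card {w \<in> words N n. des_left X w = p})"
proof -
  have "coeff (des_sum N X [:0, 1:] n) p =
      (\<Sum>w\<in>words N n. if des_left X w = p then 1 else (0::int))"
    by (simp add: des_sum_def coeff_sum monom_altdef[of 1, simplified, symmetric])
  also have "\<dots> = (\<Sum>w\<in>{w \<in> words N n. des_left X w = p}. 1)"
    by (rule sum.inter_filter[symmetric]) simp
  finally show ?thesis by simp
qed

text \<open>The sign is that of \<open>e - p\<close> when \<open>p \<le> e\<close>; for larger
  \<open>p\<close> the binomial coefficient vanishes.\<close>

lemma coeff_linear_minus_one_power: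
  "coeff ([:- 1, 1:] ^ e) p = (- 1) ^ (e + p) * int (e choose p)"
proof (induction e arbitrary: p)
  case 0
  show ?case by (cases p) simp_all
next
  case (Suc e)
  then show ?case by (cases p) (simp_all add: algebra_simps)
qed

lemma coeff_mult_of_int:
  fixes f :: "'a::comm_ring_1 poly"
  shows "coeff (f * of_int c) p = coeff f p * of_int c"
  by (simp add: of_int_poly mult.commute)

theorem theorem5p6:
  fixes s k t r n p :: nat
  assumes "s \<ge> 2" and "1 \<le> t" and "t \<le> s - 1" and "1 \<le> r" and "r \<le> t"
  shows "card {w \<in> words (s * k + t) n. des_left (residue_class s (int r)) w = p}
           = card {w \<in> words (s * k + t) n. ris_left (residue_class s (int t + 1 - int r)) w = p}
       \<and> int (card {w \<in> words (s * k + t) n. des_left (residue_class s (int r)) w = p})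
           = (\<Sum>m=0..n. \<Sum>j=0..m. \<Sum>i1=0..m - j. \<Sum>i2=0..j.
                (- 1) ^ (n + p + j) * int s ^ (m - i1 - i2)
                * (int s - int t + int r - 1) ^ i1 * (int r - 1) ^ i2
                * int (m choose j) * int ((m - j) choose i1) * int (j choose i2)
                * int ((k * j + j) choose (n - i1 - i2)) * int ((n - m) choose p))"
proof (intro conjI card_des_left_eq_card_ris_left)
  let ?N = "s * k + t"
  show "?N + 1 - x \<in> residue_class s (int t + 1 - int r) \<longleftrightarrow> x \<in> residue_class s (int r)"
    if "x \<in> {1..?N}" for x
  proof -
    \<comment> \<open>The complement matches the two classes because \<open>s * k + t\<close> is
      congruent to \<open>t\<close> modulo \<open>s\<close>.\<close>
    have "int (?N + 1 - x) - (int t + 1 - int r) = int s * int k - (int x - int r)"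
      using that by (simp add: of_nat_diff)
    moreover have "int s dvd int s * int k - (int x - int r) \<longleftrightarrow> int s dvd int x - int r"
      by (simp only: diff_conv_add_uminus[of "int s * int k"] dvd_add_right_iff[OF dvd_triv_left]
          dvd_minus_iff)
    ultimately show ?thesis
      by (simp only: residue_class_def mem_Collect_eq cong_iff_dvd_diff)
  qed
next
  let ?N = "s * k + t" and ?q = "[:0, 1:] :: int poly"
  let ?g = "\<lambda>m j i1 i2. (- 1) ^ (m + j) * int s ^ (m - i1 - i2)
        * (int s - int t + int r - 1) ^ i1 * (int r - 1) ^ i2
        * int (m choose j) * int ((m - j) choose i1) * int (j choose i2)
        * int ((k * j + j) choose (n - i1 - i2))"
  \<comment> \<open>The inner sum is a constant polynomial, so the power of \<open>q\<close> comes
    from \<open>(q - 1) ^ (n - m)\<close> alone.\<close>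
  have const: "(\<Sum>j=0..m. \<Sum>i1=0..m-j. \<Sum>i2=0..j.
        (- 1) ^ (m + j) * of_nat s ^ (m - i1 - i2)
        * (of_nat s - of_nat t + of_nat r - 1) ^ i1 * (of_nat r - 1) ^ i2
        * of_nat (m choose j) * of_nat ((m - j) choose i1) * of_nat (j choose i2)
        * of_nat ((k * j + j) choose (n - i1 - i2)))
      = (of_int (\<Sum>j=0..m. \<Sum>i1=0..m-j. \<Sum>i2=0..j. ?g m j i1 i2) :: int poly)" for m
    by simp
  have q: "?q - 1 = [:- 1, 1:]" "?q \<noteq> 1"
    by (simp_all add: one_pCons)
  have "t < s"
    using assms by simp
  then have "des_sum ?N (residue_class s (int r)) ?q n =
      (\<Sum>m\<le>n. [:- 1, 1:] ^ (n - m) * of_int (\<Sum>j=0..m. \<Sum>i1=0..m-j. \<Sum>i2=0..j. ?g m j i1 i2))"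
    using des_sum_residue_class[of r t s ?q k n, OF assms(4,5) _ q(2)] unfolding const q(1) by blast
  then have "coeff (des_sum ?N (residue_class s (int r)) ?q n) p =
      (\<Sum>m\<le>n. (- 1) ^ (n - m + p) * int ((n - m) choose p)
        * (\<Sum>j=0..m. \<Sum>i1=0..m-j. \<Sum>i2=0..j. ?g m j i1 i2))"
    by (simp only: coeff_sum coeff_mult_of_int of_int_eq_id id_apply coeff_linear_minus_one_power)
  also have "\<dots> = (\<Sum>m=0..n. \<Sum>j=0..m. \<Sum>i1=0..m - j. \<Sum>i2=0..j.
                (- 1) ^ (n + p + j) * int s ^ (m - i1 - i2)
                * (int s - int t + int r - 1) ^ i1 * (int r - 1) ^ i2
                * int (m choose j) * int ((m - j) choose i1) * int (j choose i2)
                * int ((k * j + j) choose (n - i1 - i2)) * int ((n - m) choose p))"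
    unfolding atLeast0AtMost[of n, symmetric] sum_distrib_left
  proof (intro sum.cong refl)
    fix m j i1 i2 assume "m \<in> {0..n}"
    \<comment> \<open>As \<open>m \<le> n\<close>, the exponents \<open>n - m + p\<close> and
      \<open>m + j\<close> add up to \<open>n + p + j\<close>.\<close>
    then have sgn: "(- 1 :: int) ^ (n + p + j) = (- 1) ^ (n - m + p) * (- 1) ^ (m + j)"
      by (simp add: minus_one_power_iff)
    show "(- 1) ^ (n - m + p) * int (n - m choose p) * ?g m j i1 i2 =
        (- 1) ^ (n + p + j) * int s ^ (m - i1 - i2)
                * (int s - int t + int r - 1) ^ i1 * (int r - 1) ^ i2
                * int (m choose j) * int ((m - j) choose i1) * int (j choose i2)
                * int ((k * j + j) choose (n - i1 - i2)) * int ((n - m) choose p)"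
      unfolding sgn by (simp only: mult_ac)
  qed
  finally show "int (card {w \<in> words ?N n. des_left (residue_class s (int r)) w = p}) =
      (\<Sum>m=0..n. \<Sum>j=0..m. \<Sum>i1=0..m - j. \<Sum>i2=0..j.
                (- 1) ^ (n + p + j) * int s ^ (m - i1 - i2)
                * (int s - int t + int r - 1) ^ i1 * (int r - 1) ^ i2
                * int (m choose j) * int ((m - j) choose i1) * int (j choose i2)
                * int ((k * j + j) choose (n - i1 - i2)) * int ((n - m) choose p))"
    by (simp only: coeff_des_sum)
qed

end
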